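(* Let $p\in(0,1)$ and let $Y_t=\eta_t$ (i.e. $\mu_n=0$, no signal), where $\eta_t=\epsilon_t Z_t$, $t\ge 1$, are iid with $Z_t\sim\mathcal N(0,1/p)$ and $\epsilon_t\sim\mathrm{Bin}(1,p)$ independent, so that $\sigma^2=\mathrm{Var}(\eta_t)=1$. Then $T_n^{\mathrm{DS}}\to\infty$ in probability as $n\to\infty$.
   Context: For real $0\le a<b\le n$ and $I=(a,b]$, $|I|=b-a$, the local scan statistic is $T_n(I)=\left|\sum_{t\in I}Y_t\right|/\sqrt{|I|}$, where for non-integer $a,b$ the sum is extended by linear interpolation, i.e. $\sum_{t\in(a,b]}Y_t:=P(b)-P(a)$ with $P(x)=\sum_{t=1}^{\lfloor x\rfloor}Y_t+(x-\lfloor x\rfloor)Y_{\lfloor x\rfloor+1}$. The additively penalized multiscale statistic is $$T_n^{\mathrm{DS}}=\sup_{I}\left\{T_n(I)-\sigma\sqrt{2\log\tfrac{en}{|I|}}\right\}_+,$$ the supremum being over all intervals $I=(a,b]$ with $0\le a<b\le n$, and $x_+=\max(x,0)$. *)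

theory Defs
  imports "HOL-Probability.Probability"
begin

definition interp_sum :: "(nat \<Rightarrow> real) \<Rightarrow> real \<Rightarrow> real" where
  "interp_sum Y x =
     (\<Sum>t = 1..nat \<lfloor>x\<rfloor>. Y t) + (x - of_int \<lfloor>x\<rfloor>) * Y (nat \<lfloor>x\<rfloor> + 1)"

text \<open>The interval \<open>I = (a, b]\<close> is represented by its endpoints.\<close>

definition scan_stat :: "(nat \<Rightarrow> real) \<Rightarrow> real \<Rightarrow> real \<Rightarrow> real" where
  "scan_stat Y a b = \<bar>interp_sum Y b - interp_sum Y a\<bar> / sqrt (b - a)"

text \<open>The supremum is taken in the extended reals, so that it does not depend on a convention
  for sets of reals that are unbounded or empty.\<close>

definition DS_stat :: "real \<Rightarrow> nat \<Rightarrow> (nat \<Rightarrow> real) \<Rightarrow> ereal" where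
  "DS_stat \<sigma> n Y =
     (SUP (a, b) \<in> {(a, b). 0 \<le> a \<and> a < b \<and> b \<le> real n}.
        ereal (max (scan_stat Y a b - \<sigma> * sqrt (2 * ln (exp 1 * real n / (b - a)))) 0))"

text \<open>Formulated with the events \<open>X n > K\<close> and limit 1: a non-measurable event has
  \<open>measure\<close> 0, so these events cannot satisfy the condition through lack of measurability.\<close>

definition tendsto_infinity_in_prob :: "'a measure \<Rightarrow> (nat \<Rightarrow> 'a \<Rightarrow> ereal) \<Rightarrow> bool" where
  "tendsto_infinity_in_prob M X \<longleftrightarrow>
     (\<forall>K::real. (\<lambda>n. measure M {\<omega> \<in> space M. X n \<omega> > ereal K}) \<longlonglongrightarrow> 1)"

end

theory Submission
  imports Defs "HOL-Real_Asymp.Real_Asymp"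
begin

text \<open>Unit intervals \<open>(t - 1, t]\<close> suffice. Their local statistics are the independent variables
  \<open>\<bar>\<eta> t\<bar>\<close>, and all of them carry the same penalty \<open>sqrt (2 * ln (exp 1 * n))\<close>, which is calibrated to
  standard normal tails. But \<open>\<eta> t\<close>, although of variance 1, is with probability \<open>p\<close> a normal variable
  of variance \<open>1 / p > 1\<close>, so that it exceeds the penalty plus a constant with a probability \<open>q n\<close> of
  order \<open>n powr (- p)\<close> up to subpolynomial factors. Hence \<open>n * q n\<close> tends to infinity, and none of
  \<open>n\<close> independent variables exceeds the level with probability at most \<open>exp (- n * q n)\<close>.\<close>

section \<open>Right-continuity in the endpoints and measurability of the exceedance events\<close>

text \<open>The floor is constant on a right neighbourhood of \<open>x\<close>, so a single affine
  formula applies there. Left limits, which would require matching two formulas at integers, are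
  avoided.\<close>

lemma interp_sum_tendsto_at_right:
  assumes "0 \<le> x"
  shows "(interp_sum Y \<longlongrightarrow> interp_sum Y x) (at_right x)"
proof -
  have "\<forall>\<^sub>F y in at_right x. y \<in> {x<..<of_int \<lfloor>x\<rfloor> + 1}"
    by (rule eventually_at_right_real) linarith
  then have "\<forall>\<^sub>F y in at_right x.
      (\<Sum>t = 1..nat \<lfloor>x\<rfloor>. Y t) + (y - of_int \<lfloor>x\<rfloor>) * Y (nat \<lfloor>x\<rfloor> + 1) = interp_sum Y y"
  proof eventually_elim
    case (elim y)
    then have "\<lfloor>y\<rfloor> = \<lfloor>x\<rfloor>"
      by (intro floor_unique) (auto, linarith)
    then show ?case
      by (simp add: interp_sum_def)
  qed
  moreover have "((\<lambda>y. (\<Sum>t = 1..nat \<lfloor>x\<rfloor>. Y t) + (y - of_int \<lfloor>x\<rfloor>) * Y (nat \<lfloor>x\<rfloor> + 1))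
      \<longlongrightarrow> interp_sum Y x) (at_right x)"
    unfolding interp_sum_def by (intro tendsto_intros)
  ultimately show ?thesis
    by (rule Lim_transform_eventually[rotated])
qed

text \<open>The term under the supremum in \<open>DS_stat\<close>, before its embedding into
  \<open>ereal\<close>, so that limits and measurability can be treated in the reals.\<close>

definition penalized_scan :: "real \<Rightarrow> nat \<Rightarrow> (nat \<Rightarrow> real) \<Rightarrow> real \<Rightarrow> real \<Rightarrow> real" where
  "penalized_scan \<sigma> n Y a b =
     max (scan_stat Y a b - \<sigma> * sqrt (2 * ln (exp 1 * real n / (b - a)))) 0"

lemma DS_stat_greater_iff:
  "ereal K < DS_stat \<sigma> n Y \<longleftrightarrow>
     (\<exists>a b. 0 \<le> a \<and> a < b \<and> b \<le> real n \<and> K < penalized_scan \<sigma> n Y a b)"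
  unfolding DS_stat_def penalized_scan_def[symmetric] less_SUP_iff by auto

lemma tendsto_penalized_scan:
  assumes "(f \<longlongrightarrow> a) F" "(g \<longlongrightarrow> b) F" "a < b" "0 < n"
    and "((\<lambda>x. interp_sum Y (f x)) \<longlongrightarrow> interp_sum Y a) F"
    and "((\<lambda>x. interp_sum Y (g x)) \<longlongrightarrow> interp_sum Y b) F"
  shows "((\<lambda>x. penalized_scan \<sigma> n Y (f x) (g x)) \<longlongrightarrow> penalized_scan \<sigma> n Y a b) F"
  unfolding penalized_scan_def scan_stat_def
  using assms by (intro tendsto_intros) auto

text \<open>Interpolated sums are right-continuous, so both endpoints may be moved slightly to the right,
  except that the endpoint \<open>n\<close> stays where it is.\<close>

lemma rational_penalized_scan:
  assumes ab: "0 \<le> a" "a < b" "b \<le> real n" and K: "K < penalized_scan \<sigma> n Y a b"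
  shows "\<exists>a'\<in>\<rat>. \<exists>b'\<in>\<rat>. 0 \<le> a' \<and> a' < b' \<and> b' \<le> real n \<and> K < penalized_scan \<sigma> n Y a' b'"
proof -
  have n: "0 < n"
    using ab by (cases n) auto
  \<comment> \<open>The right endpoint is moved first, with \<open>a\<close> fixed; the left
    endpoint is then moved for the \<open>b'\<close> so obtained, hence the general
    \<open>b'\<close> here.\<close>
  have left: "\<exists>a'\<in>\<rat>. 0 \<le> a' \<and> a' < b' \<and> K < penalized_scan \<sigma> n Y a' b'"
    if b': "a < b'" "K < penalized_scan \<sigma> n Y a b'" for b'
  proof -
    have "((\<lambda>x. penalized_scan \<sigma> n Y x b') \<longlongrightarrow> penalized_scan \<sigma> n Y a b') (at_right a)"
      using ab b' n by (intro tendsto_penalized_scan interp_sum_tendsto_at_right tendsto_ident_at)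
        auto
    from order_tendstoD(1)[OF this b'(2)] obtain c where
      c: "a < c" "\<And>x. a < x \<Longrightarrow> x < c \<Longrightarrow> K < penalized_scan \<sigma> n Y x b'"
      unfolding eventually_at_right_field by blast
    obtain a' where "a' \<in> \<rat>" "a < a'" "a' < min c b'"
      using Rats_dense_in_real[of a "min c b'"] c(1) b' by auto
    then show ?thesis
      using c ab by (intro bexI[of _ a']) auto
  qed
  have "\<exists>b'\<in>\<rat>. a < b' \<and> b' \<le> real n \<and> K < penalized_scan \<sigma> n Y a b'"
  proof (cases "b = real n")
    case True
    then show ?thesis
      using ab K by (intro bexI[of _ b]) auto
  next
    case False
    have "((\<lambda>x. penalized_scan \<sigma> n Y a x) \<longlongrightarrow> penalized_scan \<sigma> n Y a b) (at_right b)"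
      using ab n by (intro tendsto_penalized_scan interp_sum_tendsto_at_right tendsto_ident_at)
        auto
    from order_tendstoD(1)[OF this K] obtain c where
      c: "b < c" "\<And>x. b < x \<Longrightarrow> x < c \<Longrightarrow> K < penalized_scan \<sigma> n Y a x"
      unfolding eventually_at_right_field by blast
    obtain b' where "b' \<in> \<rat>" "b < b'" "b' < min c (real n)"
      using Rats_dense_in_real[of b "min c (real n)"] c(1) ab False by auto
    then show ?thesis
      using c ab by (intro bexI[of _ b']) auto
  qed
  then show ?thesis
    using left by blast
qed

text \<open>The supremum runs over uncountably many intervals, but rational endpoints already detect
  an exceedance, which leaves a countable union of events.\<close>

lemma measurable_DS_stat_greater:
  assumes [measurable]: "\<And>t. t \<ge> 1 \<Longrightarrow> \<eta> t \<in> borel_measurable M"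
  shows "{\<omega> \<in> space M. ereal K < DS_stat \<sigma> n (\<lambda>t. \<eta> t \<omega>)} \<in> sets M"
proof -
  let ?R = "{(a, b). a \<in> \<rat> \<and> b \<in> \<rat> \<and> 0 \<le> a \<and> a < b \<and> b \<le> real n}"
  have "countable ?R"
    by (rule countable_subset[of _ "\<rat> \<times> \<rat>"]) (auto simp: countable_rat)
  moreover have [measurable]: "(\<lambda>\<omega>. interp_sum (\<lambda>t. \<eta> t \<omega>) x) \<in> borel_measurable M" for x
    unfolding interp_sum_def by (intro borel_measurable_add borel_measurable_sum
        borel_measurable_times assms) auto
  have "{\<omega> \<in> space M. K < penalized_scan \<sigma> n (\<lambda>t. \<eta> t \<omega>) a b} \<in> sets M" for a b
    unfolding penalized_scan_def scan_stat_def by measurable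
  ultimately have "(\<Union>(a, b)\<in>?R. {\<omega> \<in> space M. K < penalized_scan \<sigma> n (\<lambda>t. \<eta> t \<omega>) a b}) \<in> sets M"
    by (intro sets.countable_UN') auto
  also have "(\<Union>(a, b)\<in>?R. {\<omega> \<in> space M. K < penalized_scan \<sigma> n (\<lambda>t. \<eta> t \<omega>) a b}) =
      {\<omega> \<in> space M. ereal K < DS_stat \<sigma> n (\<lambda>t. \<eta> t \<omega>)}"
    unfolding DS_stat_greater_iff by (safe; (drule (3) rational_penalized_scan)?; blast)
  finally show ?thesis .
qed

section \<open>Lower bound of the statistic by unit intervals\<close>

lemma penalized_scan_unit_interval:
  assumes "t \<ge> 1"
  shows "\<bar>Y t\<bar> - \<sigma> * sqrt (2 * ln (exp 1 * real n)) \<le> penalized_scan \<sigma> n Y (real (t - 1)) (real t)"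
proof -
  obtain k where k: "t = Suc k"
    using assms by (cases t) auto
  \<comment> \<open>At integer endpoints the interpolation weight vanishes, and the length is
    1.\<close>
  have "scan_stat Y (real (t - 1)) (real t) = \<bar>Y t\<bar>"
    unfolding scan_stat_def interp_sum_def k by (simp add: nat_add_distrib)
  then show ?thesis
    using assms unfolding penalized_scan_def by (simp add: of_nat_diff)
qed

lemma DS_stat_greaterI:
  assumes "t \<in> {1..n}" "K + \<sigma> * sqrt (2 * ln (exp 1 * real n)) < \<bar>Y t\<bar>"
  shows "ereal K < DS_stat \<sigma> n Y"
  unfolding DS_stat_greater_iff
  using assms penalized_scan_unit_interval[of t Y \<sigma> n]
  by (intro exI[of _ "real (t - 1)"] exI[of _ "real t"]) (auto simp: of_nat_diff)

section \<open>Tail and variance of a normal variable thinned by a Bernoulli variable\<close>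

text \<open>The density decreases on the positive half-line, so the mass of
  \<open>{c<..c + 1}\<close> is at least its length 1 times the density at the right end. This crude
  bound is sharp enough here: for \<open>c\<close> of order \<open>sqrt (ln n)\<close> the shift by
  1 costs only a subpolynomial factor.\<close>

lemma (in prob_space) normal_tail_ge:
  assumes X: "distributed M lborel X (normal_density 0 s)" and "0 < s" "0 \<le> c"
  shows "normal_density 0 s (c + 1) \<le> prob {\<omega> \<in> space M. c < \<bar>X \<omega>\<bar>}"
proof -
  have [measurable]: "X \<in> borel_measurable M"
    using distributed_measurable[OF X] by simp
  have "ennreal (normal_density 0 s (c + 1)) =
      (\<integral>\<^sup>+x. ennreal (normal_density 0 s (c + 1)) * indicator {c<..c + 1} x \<partial>lborel)"
    by (subst nn_integral_cmult_indicator) auto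
  also have "\<dots> \<le> (\<integral>\<^sup>+x. ennreal (normal_density 0 s x) * indicator {c<..c + 1} x \<partial>lborel)"
    using assms
    by (intro nn_integral_mono)
       (auto simp: indicator_def normal_density_def intro!: ennreal_leI divide_right_mono power_mono)
  also have "\<dots> = emeasure M (X -` {c<..c + 1} \<inter> space M)"
    by (rule distributed_emeasure[OF X, symmetric]) simp
  also have "\<dots> = ennreal (prob (X -` {c<..c + 1} \<inter> space M))"
    by (rule emeasure_eq_measure)
  finally have "normal_density 0 s (c + 1) \<le> prob (X -` {c<..c + 1} \<inter> space M)"
    by simp
  also have "\<dots> \<le> prob {\<omega> \<in> space M. c < \<bar>X \<omega>\<bar>}"
    by (rule finite_measure_mono) auto
  finally show ?thesis .
qed

text \<open>Independence is stated for the real-valued version of the Bernoulli variable; rounding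
  down recovers the variable itself.\<close>

lemma measurable_of_real_nat:
  assumes "(\<lambda>\<omega>. real (N \<omega>)) \<in> borel_measurable M"
  shows "N \<in> measurable M (count_space UNIV)"
proof -
  have "(\<lambda>\<omega>. nat \<lfloor>real (N \<omega>)\<rfloor>) \<in> measurable M (count_space UNIV)"
    using assms by measurable
  then show ?thesis
    by simp
qed

context prob_space
begin

context
  fixes p :: real and N :: "'a \<Rightarrow> nat" and X :: "'a \<Rightarrow> real"
  assumes p: "0 < p" "p < 1"
    and X: "distributed M lborel X (normal_density 0 (sqrt (1 / p)))"
    and N: "distr M (count_space UNIV) N = measure_pmf (binomial_pmf 1 p)"
    and indep: "indep_var borel (\<lambda>\<omega>. real (N \<omega>)) borel X"
begin

lemma bernoulli_measurable: "N \<in> measurable M (count_space UNIV)"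
  using indep_var_rv1[OF indep] by (rule measurable_of_real_nat)

lemma expectation_bernoulli:
  fixes f :: "nat \<Rightarrow> real"
  shows "integrable M (\<lambda>\<omega>. f (N \<omega>))"
    and "expectation (\<lambda>\<omega>. f (N \<omega>)) = (1 - p) * f 0 + p * f 1"
proof -
  have "integrable (measure_pmf (binomial_pmf 1 p)) f"
    using p by simp
  then show "integrable M (\<lambda>\<omega>. f (N \<omega>))"
    unfolding N[symmetric] using bernoulli_measurable by (subst (asm) integrable_distr_eq) auto
  have "expectation (\<lambda>\<omega>. f (N \<omega>)) = measure_pmf.expectation (binomial_pmf 1 p) f"
    unfolding N[symmetric] using bernoulli_measurable by (subst integral_distr) auto
  also have "\<dots> = (1 - p) * f 0 + p * f 1"
    using p by (simp add: expectation_binomial_pmf')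
  finally show "expectation (\<lambda>\<omega>. f (N \<omega>)) = (1 - p) * f 0 + p * f 1" .
qed

lemma prob_bernoulli_eq_1: "prob {\<omega> \<in> space M. real (N \<omega>) = 1} = p"
proof -
  have "prob {\<omega> \<in> space M. real (N \<omega>) = 1} =
      expectation (indicator {\<omega> \<in> space M. real (N \<omega>) = 1})"
    by (simp add: Int_def conj_commute)
  also have "\<dots> = expectation (\<lambda>\<omega>. of_bool (N \<omega> = 1))"
    by (rule Bochner_Integration.integral_cong) (auto simp: indicator_def)
  also have "\<dots> = p"
    by (subst expectation_bernoulli(2)) simp
  finally show ?thesis .
qed

text \<open>The mean is 0, and by independence of the squares the second moment is
  \<open>p * (1 / p)\<close>.\<close>

lemma variance_thinned_normal: "variance (\<lambda>\<omega>. real (N \<omega>) * X \<omega>) = 1"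
proof -
  have [measurable]: "X \<in> borel_measurable M"
    using distributed_measurable[OF X] by simp
  have EX: "expectation X = 0" and EX2: "expectation (\<lambda>\<omega>. (X \<omega>)\<^sup>2) = 1 / p"
    using normal_distributed_expectation[OF _ X] normal_distributed_variance[OF _ X] p
    by auto
  \<comment> \<open>A non-integrable function has integral 0 by convention, so the nonzero value
    \<open>1 / p\<close> proves integrability.\<close>
  then have iX2: "integrable M (\<lambda>\<omega>. (X \<omega>)\<^sup>2)"
    using not_integrable_integral_eq[of M "\<lambda>\<omega>. (X \<omega>)\<^sup>2"] p by auto
  then have iX: "integrable M X"
    by (rule square_integrable_imp_integrable[rotated]) simp
  have "expectation (\<lambda>\<omega>. real (N \<omega>) * X \<omega>) = 0"
    using indep_var_lebesgue_integral[OF indep expectation_bernoulli(1)[of real] iX] EX by simp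
  moreover have "indep_var borel (\<lambda>\<omega>. (real (N \<omega>))\<^sup>2) borel (\<lambda>\<omega>. (X \<omega>)\<^sup>2)"
    using indep_var_compose[OF indep, of "\<lambda>x. x\<^sup>2" borel "\<lambda>x. x\<^sup>2" borel] by (simp add: o_def)
  from indep_var_lebesgue_integral[OF this expectation_bernoulli(1)[of "\<lambda>k. (real k)\<^sup>2"] iX2]
  have "expectation (\<lambda>\<omega>. (real (N \<omega>) * X \<omega>)\<^sup>2) = 1"
    using p by (simp add: EX2 expectation_bernoulli(2)[of "\<lambda>k. (real k)\<^sup>2"] power_mult_distrib)
  ultimately show ?thesis
    by simp
qed

text \<open>On the event \<open>N \<omega> = 1\<close> the product is \<open>X \<omega>\<close>;
  independence turns the probability of this event into the factor \<open>p\<close>.\<close>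

lemma thinned_normal_tail_ge:
  assumes "0 \<le> c"
  shows "p * normal_density 0 (sqrt (1 / p)) (c + 1) \<le>
    prob {\<omega> \<in> space M. c < \<bar>real (N \<omega>) * X \<omega>\<bar>}"
proof -
  have [measurable]: "X \<in> borel_measurable M" "(\<lambda>\<omega>. real (N \<omega>)) \<in> borel_measurable M"
    using indep_var_rv1[OF indep] indep_var_rv2[OF indep] by auto
  have "p * normal_density 0 (sqrt (1 / p)) (c + 1) \<le>
      prob {\<omega> \<in> space M. real (N \<omega>) = 1} * prob {\<omega> \<in> space M. c < \<bar>X \<omega>\<bar>}"
    unfolding prob_bernoulli_eq_1 using p assms X by (intro mult_left_mono normal_tail_ge) auto
  also have "\<dots> = prob ((\<lambda>\<omega>. (real (N \<omega>), X \<omega>)) -` ({1} \<times> {x. c < \<bar>x\<bar>}) \<inter> space M)"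
    by (subst indep_varD[OF indep]) (auto intro!: arg_cong2[where f = "(*)"] arg_cong[where f = prob])
  also have "\<dots> \<le> prob {\<omega> \<in> space M. c < \<bar>real (N \<omega>) * X \<omega>\<bar>}"
    by (rule finite_measure_mono) auto
  finally show ?thesis .
qed

end

section \<open>Exceedances among \<open>n\<close> independent variables and growth of their expected
  number\<close>

text \<open>By independence, the probability that no variable exceeds \<open>c\<close> is a product
  of \<open>n\<close> factors, each at most \<open>1 - q \<le> exp (- q)\<close>.\<close>

lemma prob_max_abs_greater_ge:
  fixes \<eta> :: "nat \<Rightarrow> 'a \<Rightarrow> real"
  assumes indep: "indep_vars (\<lambda>_. borel) \<eta> {1..}" and "0 < n"
    and q: "\<And>t. t \<ge> 1 \<Longrightarrow> q \<le> prob {\<omega> \<in> space M. c < \<bar>\<eta> t \<omega>\<bar>}"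
  shows "1 - exp (- (real n * q)) \<le> prob {\<omega> \<in> space M. \<exists>t\<in>{1..n}. c < \<bar>\<eta> t \<omega>\<bar>}"
proof -
  have [measurable]: "\<eta> t \<in> borel_measurable M" if "t \<ge> 1" for t
    using indep that by (auto simp: indep_vars_def2)
  let ?A = "\<lambda>t. \<eta> t -` {x. \<bar>x\<bar> \<le> c} \<inter> space M"
  have A: "?A t \<in> events" if "t \<ge> 1" for t
    using that by (intro measurable_sets[of _ _ borel]) auto
  have "prob (\<Inter>t\<in>{1..n}. ?A t) = (\<Prod>t\<in>{1..n}. prob (?A t))"
    \<comment> \<open>An empty intersection would be \<open>UNIV\<close> instead of
      \<open>space M\<close>, hence \<open>0 < n\<close>.\<close>
    using \<open>0 < n\<close> by (intro indep_varsD[OF indep]) auto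
  also have "\<dots> \<le> (\<Prod>t\<in>{1..n}. exp (- q))"
  proof (rule prod_mono)
    fix t assume t: "t \<in> {1..n}"
    have "{\<omega> \<in> space M. c < \<bar>\<eta> t \<omega>\<bar>} = space M - ?A t"
      by auto
    then have "prob (?A t) \<le> 1 - q"
      using q[of t] prob_compl[OF A, of t] t by simp
    also have "\<dots> \<le> exp (- q)"
      using exp_ge_add_one_self[of "- q"] by simp
    finally show "0 \<le> prob (?A t) \<and> prob (?A t) \<le> exp (- q)"
      by simp
  qed
  also have "\<dots> = exp (- (real n * q))"
    by (simp add: exp_of_nat_mult[symmetric])
  finally have "1 - exp (- (real n * q)) \<le> 1 - prob (\<Inter>t\<in>{1..n}. ?A t)"
    by simp
  also have "\<dots> = prob (space M - (\<Inter>t\<in>{1..n}. ?A t))"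
    using A \<open>0 < n\<close> by (intro prob_compl[symmetric] sets.finite_INT) auto
  also have "space M - (\<Inter>t\<in>{1..n}. ?A t) = {\<omega> \<in> space M. \<exists>t\<in>{1..n}. c < \<bar>\<eta> t \<omega>\<bar>}"
    using \<open>0 < n\<close> by (force simp: not_le)
  finally show ?thesis .
qed

end

text \<open>With \<open>x = sqrt (2 * ln (exp 1 * n))\<close> one has \<open>n = exp (x\<^sup>2 / 2 - 1)\<close>, so the expression below is
  the exponential of a quadratic polynomial in \<open>x\<close> whose leading coefficient \<open>(1 - p) / 2\<close> is
  positive.\<close>

lemma thinned_tail_sum_at_top:
  fixes p K :: real
  assumes p: "0 < p" "p < 1"
  shows "filterlim (\<lambda>n::nat. real n *
      (p * normal_density 0 (sqrt (1 / p)) (K + sqrt (2 * ln (exp 1 * real n)) + 1)))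
    at_top at_top"
proof -
  define x where "x n = sqrt (2 * ln (exp 1 * real n))" for n :: nat
  define C where "C = p / sqrt (2 * pi * (1 / p))"
  have C: "C > 0"
    using p by (simp add: C_def)
  \<comment> \<open>The exponent is the expansion of
    \<open>u\<^sup>2 / 2 - 1 - p * (u + K + 1)\<^sup>2 / 2\<close>: the first two terms come from
    \<open>n\<close>, the last from the normal density; \<open>C\<close> collects the constant
    factors.\<close>
  define g where "g u = C * exp (((1 - p) / 2) * u\<^sup>2 - p * (K + 1) * u - (1 + p * (K + 1)\<^sup>2 / 2))"
    for u
  have "0 < (1 - p) / 2"
    using p by simp
  then have "filterlim g at_top at_top"
    unfolding g_def using C by real_asymp
  moreover have "filterlim x at_top sequentially"
    unfolding x_def by real_asymp
  ultimately have "filterlim (\<lambda>n. g (x n)) at_top sequentially"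
    by (rule filterlim_compose)
  moreover have "\<forall>\<^sub>F n in sequentially.
      g (x n) = real n * (p * normal_density 0 (sqrt (1 / p)) (K + x n + 1))"
    using eventually_gt_at_top[of 0]
  proof eventually_elim
    case (elim n)
    then have "(x n)\<^sup>2 / 2 - 1 = ln (real n)"
      by (simp add: x_def ln_mult add_divide_distrib)
    then have "real n = exp ((x n)\<^sup>2 / 2 - 1)"
      using elim by simp
    then have "real n * (p * normal_density 0 (sqrt (1 / p)) (K + x n + 1)) =
        C * (exp ((x n)\<^sup>2 / 2 - 1) * exp (- (K + x n + 1)\<^sup>2 / (2 * (1 / p))))"
      using p by (simp add: normal_density_def C_def)
    also have "exp ((x n)\<^sup>2 / 2 - 1) * exp (- (K + x n + 1)\<^sup>2 / (2 * (1 / p))) =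
        exp (((1 - p) / 2) * (x n)\<^sup>2 - p * (K + 1) * x n - (1 + p * (K + 1)\<^sup>2 / 2))"
      unfolding exp_add[symmetric] by (simp add: field_simps power2_eq_square)
    finally show ?case
      by (simp add: g_def)
  qed
  ultimately show ?thesis
    unfolding x_def by (rule filterlim_mono_eventually[OF _ order_refl order_refl])
qed

theorem proposition1p1:
  fixes M :: "'a measure"
    and p \<sigma> :: real
    and \<epsilon> :: "nat \<Rightarrow> 'a \<Rightarrow> nat"
    and Z \<eta> :: "nat \<Rightarrow> 'a \<Rightarrow> real"
  assumes "prob_space M"
    and "0 < p" and "p < 1"
    and "\<And>t. t \<ge> 1 \<Longrightarrow> distributed M lborel (Z t) (normal_density 0 (sqrt (1 / p)))"
    and "\<And>t. t \<ge> 1 \<Longrightarrow> distr M (count_space UNIV) (\<epsilon> t) = measure_pmf (binomial_pmf 1 p)"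
    and "\<And>t. t \<ge> 1 \<Longrightarrow> prob_space.indep_var M borel (\<lambda>\<omega>. real (\<epsilon> t \<omega>)) borel (Z t)"
    and "\<And>t \<omega>. t \<ge> 1 \<Longrightarrow> \<eta> t \<omega> = real (\<epsilon> t \<omega>) * Z t \<omega>"
    and "prob_space.indep_vars M (\<lambda>_. borel) \<eta> {1..}"
    and "\<sigma> > 0"
    and "\<And>t. t \<ge> 1 \<Longrightarrow> \<sigma>\<^sup>2 = prob_space.variance M (\<eta> t)"
  shows "\<sigma>\<^sup>2 = 1 \<and>
    tendsto_infinity_in_prob M (\<lambda>n \<omega>. DS_stat \<sigma> n (\<lambda>t. \<eta> t \<omega>))"
proof -
  interpret prob_space M
    by fact
  note p = assms(2,3) and indep = assms(8)
  have \<eta>: "\<eta> t = (\<lambda>\<omega>. real (\<epsilon> t \<omega>) * Z t \<omega>)" if "t \<ge> 1" for t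
    using assms(7)[OF that] by auto
  have \<sigma>2: "\<sigma>\<^sup>2 = 1"
    using variance_thinned_normal[OF p assms(4-6)[of 1]] assms(10)[of 1] \<eta>[of 1] by simp
  \<comment> \<open>Positivity selects the root, which makes the penalty exactly
    \<open>sqrt (2 * ln (exp 1 * n))\<close>.\<close>
  then have \<sigma>: "\<sigma> = 1"
    using \<open>\<sigma> > 0\<close> by (simp add: power2_eq_1_iff)
  have meas: "\<eta> t \<in> borel_measurable M" if "t \<ge> 1" for t
    using indep that by (auto simp: indep_vars_def2)
  have "(\<lambda>n. prob {\<omega> \<in> space M. ereal K < DS_stat \<sigma> n (\<lambda>t. \<eta> t \<omega>)}) \<longlonglongrightarrow> 1" for K
  proof -
    \<comment> \<open>\<open>c n\<close> is the level that \<open>\<bar>\<eta> t\<bar>\<close> must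
      exceed on a unit interval, and \<open>q n\<close> bounds the probability of this from below
      once \<open>c n\<close> is nonnegative.\<close>
    define c where "c n = K + sqrt (2 * ln (exp 1 * real n))" for n :: nat
    define q where "q n = p * normal_density 0 (sqrt (1 / p)) (c n + 1)" for n
    have nq: "filterlim (\<lambda>n. real n * q n) at_top sequentially"
      unfolding q_def c_def by (rule thinned_tail_sum_at_top[OF p])
    then have "(\<lambda>n. 1 - exp (- (real n * q n))) \<longlonglongrightarrow> 1 - 0"
      by (intro tendsto_intros filterlim_compose[OF exp_at_bot]
          filterlim_compose[OF filterlim_uminus_at_bot_at_top])
    then have lower: "(\<lambda>n. 1 - exp (- (real n * q n))) \<longlonglongrightarrow> 1"
      by simp
    \<comment> \<open>The tail bound needs a nonnegative level; as \<open>K\<close> may be negative,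
      this holds only for large \<open>n\<close>.\<close>
    have "filterlim c at_top sequentially"
      unfolding c_def by real_asymp
    then have "\<forall>\<^sub>F n in sequentially. 0 \<le> c n"
      by (auto simp: filterlim_at_top)
    then have "\<forall>\<^sub>F n in sequentially. 1 - exp (- (real n * q n)) \<le>
        prob {\<omega> \<in> space M. ereal K < DS_stat \<sigma> n (\<lambda>t. \<eta> t \<omega>)}"
      using eventually_gt_at_top[of 0]
    proof eventually_elim
      case (elim n)
      have "1 - exp (- (real n * q n)) \<le> prob {\<omega> \<in> space M. \<exists>t\<in>{1..n}. c n < \<bar>\<eta> t \<omega>\<bar>}"
        using thinned_normal_tail_ge[OF p assms(4-6), of _ "c n"] elim
        by (intro prob_max_abs_greater_ge[OF indep]) (auto simp: q_def \<eta>)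
      also have "\<dots> \<le> prob {\<omega> \<in> space M. ereal K < DS_stat \<sigma> n (\<lambda>t. \<eta> t \<omega>)}"
        \<comment> \<open>Monotonicity of the probability needs the larger event to be
          measurable.\<close>
        using measurable_DS_stat_greater[of \<eta> M, OF meas]
        by (intro finite_measure_mono) (auto simp: c_def \<sigma> intro: DS_stat_greaterI)
      finally show ?case .
    qed
    then show ?thesis
      by (rule tendsto_sandwich[OF _ _ lower tendsto_const]) simp
  qed
  then show ?thesis
    using \<sigma>2 by (simp add: tendsto_infinity_in_prob_def)
qed

end
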